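(* For all $n$ and all $k\ge3$, $$|\mathcal S_n(132,\,12\cdots k)|=|\mathcal S_n(132,\,213\cdots k)|.$$
   Context: $\mathcal S_n(\tau_1,\tau_2)$ is the set of permutations $\pi=\pi_1\cdots\pi_n$ of $\{1,\dots,n\}$ avoiding both patterns $\tau_1$ and $\tau_2$, where $\pi$ avoids $\tau\in\mathcal S_k$ if there are no $i_1<\dots<i_k$ such that $\pi_{i_1}\cdots\pi_{i_k}$ is in the same relative order as $\tau_1\cdots\tau_k$. Here $12\cdots k$ is the identity permutation of length $k$ and $213\cdots k$ is the permutation $2,1,3,4,\dots,k$. *)

theory Defs
  imports "HOL-Combinatorics.Multiset_Permutations" "HOL-Library.Sublist"
begin

text \<open>
  A permutation of \<open>{1..n}\<close> is written in one-line notation, as a list; list positions are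
  counted from 0.
\<close>

definition same_relative_order :: "nat list \<Rightarrow> nat list \<Rightarrow> bool" where
  "same_relative_order xs ys \<longleftrightarrow>
     length xs = length ys \<and>
     (\<forall>i < length xs. \<forall>j < length xs. xs ! i < xs ! j \<longleftrightarrow> ys ! i < ys ! j)"

text \<open>
  The lists \<open>\<sigma>\<close> with \<open>subseq \<sigma> \<pi>\<close> are the words read off from \<open>\<pi>\<close> at increasing, not
  necessarily consecutive, positions.
\<close>

definition avoids :: "nat list \<Rightarrow> nat list \<Rightarrow> bool" where
  "avoids \<pi> \<tau> \<longleftrightarrow> \<not> (\<exists>\<sigma>. subseq \<sigma> \<pi> \<and> same_relative_order \<sigma> \<tau>)"

definition avoiders :: "nat \<Rightarrow> nat list \<Rightarrow> nat list \<Rightarrow> nat list set" where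
  "avoiders n \<tau>\<^sub>1 \<tau>\<^sub>2 = {\<pi> \<in> permutations_of_set {1..n}. avoids \<pi> \<tau>\<^sub>1 \<and> avoids \<pi> \<tau>\<^sub>2}"

end

theory Submission
  imports Defs
begin

text \<open>
  Cut a permutation at its maximum \<open>M\<close>, as \<open>L @ M # R\<close>. It avoids 132 exactly when \<open>L\<close> and
  \<open>R\<close> do and every entry of \<open>R\<close> lies below every entry of \<open>L\<close>: an ascent from \<open>L\<close> to \<open>R\<close>
  would form a 132 together with \<open>M\<close>. Consider now a pattern \<open>\<sigma> @ [m]\<close> with \<open>\<sigma> \<noteq> []\<close>
  that ends with its strict maximum. None of its occurrences can begin in \<open>L\<close> and end in
  \<open>R\<close>, because its last entry is its largest; so it lies in \<open>R\<close>, or it consists of an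
  occurrence of \<open>\<sigma>\<close> in \<open>L\<close> that is completed by \<open>M\<close> or by an entry of \<open>L\<close>. Hence
  \<open>L @ M # R\<close> avoids \<open>\<sigma> @ [m]\<close> if and only if \<open>L\<close> avoids \<open>\<sigma>\<close> and \<open>R\<close> avoids
  \<open>\<sigma> @ [m]\<close> (\<open>avoids_snoc_split_at_max\<close>).

  This gives a recursion for the number of permutations that avoid 132 and \<open>\<sigma> @ [m]\<close>
  (\<open>card_avoiders_on_snoc\<close>), in which \<open>\<sigma>\<close> enters only through the number of
  permutations that avoid 132 and \<open>\<sigma>\<close>. Therefore, if \<open>\<sigma>\<close> and \<open>\<sigma>'\<close> are equinumerously
  avoided together with 132, so are their extensions by a new maximum
  (\<open>card_avoiders_on_snoc_cong\<close>). The patterns \<open>12\<cdots>k\<close> and \<open>213\<cdots>k\<close> arise in this way from 12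
  and 21, each of which is avoided by a single permutation of a given set, and that permutation is
  monotone, so it avoids 132.

  All counts are made over permutations of an arbitrary finite set of numbers instead of an
  initial segment, so that \<open>L\<close> and \<open>R\<close> are objects of the same kind and need not be
  relabelled.
\<close>

definition avoiders_on :: "nat set \<Rightarrow> nat list \<Rightarrow> nat list set" where
  "avoiders_on A \<tau> = {\<pi> \<in> permutations_of_set A. avoids \<pi> [1, 3, 2] \<and> avoids \<pi> \<tau>}"

lemma finite_avoiders_on [simp]: "finite (avoiders_on A \<tau>)"
  by (simp add: avoiders_on_def)

section \<open>Cutting a permutation at its maximum\<close>

lemma set_subseq_subset: "subseq xs ys \<Longrightarrow> set xs \<subseteq> set ys"
  by (auto elim: list_emb_set)

lemma avoids_subseq: "avoids \<pi> \<tau> \<Longrightarrow> subseq \<rho> \<pi> \<Longrightarrow> avoids \<rho> \<tau>"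
  unfolding avoids_def using subseq_order.order_trans by blast

text \<open>
  Patterns that end with their maximum occur recursively; this equivalence is what makes the
  last entry of \<open>12\<cdots>k\<close> and of \<open>213\<cdots>k\<close> removable.
\<close>

lemma same_relative_order_snoc:
  assumes "\<forall>b \<in> set t. b < y"
  shows "same_relative_order (s @ [x]) (t @ [y]) \<longleftrightarrow>
           same_relative_order s t \<and> (\<forall>a \<in> set s. a < x)"
proof
  assume o: "same_relative_order (s @ [x]) (t @ [y])"
  then have len: "length s = length t"
    and ord: "\<And>i j. i \<le> length s \<Longrightarrow> j \<le> length s \<Longrightarrow>
                (s @ [x]) ! i < (s @ [x]) ! j \<longleftrightarrow> (t @ [y]) ! i < (t @ [y]) ! j"
    by (auto simp: same_relative_order_def less_Suc_eq_le)
  have "s ! i < s ! j \<longleftrightarrow> t ! i < t ! j" if "i < length s" "j < length s" for i j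
    using ord[of i j] that len by (simp add: nth_append)
  moreover have "s ! i < x" if "i < length s" for i
    using ord[of i "length s"] that len assms by (simp add: nth_append)
  ultimately show "same_relative_order s t \<and> (\<forall>a \<in> set s. a < x)"
    using len by (auto simp: same_relative_order_def in_set_conv_nth)
next
  assume o: "same_relative_order s t \<and> (\<forall>a \<in> set s. a < x)"
  then have len: "length s = length t"
    by (simp add: same_relative_order_def)
  have "(s @ [x]) ! i < (s @ [x]) ! j \<longleftrightarrow> (t @ [y]) ! i < (t @ [y]) ! j"
    if "i < Suc (length s)" "j < Suc (length s)" for i j
  proof -
    have "s ! i < x" "t ! i < y" if "i < length s" for i
      using o assms that len by auto
    then have "s ! i < x" "t ! i < y" "\<not> x < s ! i" "\<not> y < t ! i" if "i < length s" for i
      using that by (simp_all add: less_imp_le not_less)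
    then show ?thesis
      using that o len by (auto simp: same_relative_order_def nth_append less_Suc_eq)
  qed
  then show "same_relative_order (s @ [x]) (t @ [y])"
    using len by (auto simp: same_relative_order_def)
qed

lemma avoids_132_iff:
  "avoids \<pi> [1, 3, 2] \<longleftrightarrow> \<not> (\<exists>a b c. subseq [a, b, c] \<pi> \<and> a < c \<and> c < b)"
proof -
  have *: "same_relative_order \<sigma> [1, 3, 2] \<longleftrightarrow> (\<exists>a b c. \<sigma> = [a, b, c] \<and> a < c \<and> c < b)" for \<sigma>
  proof -
    have "same_relative_order [a, b, c] [1, 3, 2] \<longleftrightarrow> a < c \<and> c < b" for a b c
      by (auto simp: same_relative_order_def less_Suc_eq all_conj_distrib numeral_eq_Suc)
    moreover have "\<exists>a b c. \<sigma> = [a, b, c]" if "same_relative_order \<sigma> [1, 3, 2]"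
      using that by (auto simp: same_relative_order_def length_Suc_conv)
    ultimately show ?thesis
      by blast
  qed
  show ?thesis
    unfolding avoids_def * by blast
qed

text \<open>
  Once \<open>R\<close> lies below \<open>L\<close>, the 1 of a 132 cannot be in \<open>L\<close> while its 2 is in \<open>R\<close>. Since
  \<open>M\<close> could only be the 3, the occurrence stays inside \<open>L\<close> or inside \<open>R\<close>.
\<close>

lemma avoids_132_split_at_max:
  assumes "distinct (L @ M # R)" and "\<forall>x \<in> set L \<union> set R. x < M"
  shows "avoids (L @ M # R) [1, 3, 2] \<longleftrightarrow>
           avoids L [1, 3, 2] \<and> avoids R [1, 3, 2] \<and> (\<forall>l \<in> set L. \<forall>r \<in> set R. r < l)"
proof
  assume av: "avoids (L @ M # R) [1, 3, 2]"
  have "r < l" if "l \<in> set L" "r \<in> set R" for l r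
  proof -
    have "subseq ([l] @ [M, r]) (L @ M # R)"
      using that by (intro list_emb_append_mono) (auto simp: subseq_singleton_left)
    then have "subseq [l, M, r] (L @ M # R)"
      by simp
    then have "\<not> (l < r \<and> r < M)"
      using av unfolding avoids_132_iff by blast
    moreover have "r < M" "l \<noteq> r"
      using that assms by auto
    ultimately show ?thesis
      by simp
  qed
  moreover have "subseq L (L @ M # R)" "subseq R (L @ M # R)"
    by auto
  ultimately show "avoids L [1, 3, 2] \<and> avoids R [1, 3, 2] \<and> (\<forall>l \<in> set L. \<forall>r \<in> set R. r < l)"
    using av avoids_subseq by blast
next
  assume av: "avoids L [1, 3, 2] \<and> avoids R [1, 3, 2] \<and> (\<forall>l \<in> set L. \<forall>r \<in> set R. r < l)"
  show "avoids (L @ M # R) [1, 3, 2]"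
    unfolding avoids_132_iff
  proof clarify
    fix a b c assume sub: "subseq [a, b, c] (L @ M # R)" and "a < c" "c < b"
    obtain u v where uv: "[a, b, c] = u @ v" and u: "subseq u L" and v: "subseq v (M # R)"
      using sub unfolding subseq_append_iff by blast
    have inR: "set v \<subseteq> insert M (set R)" and inL: "set u \<subseteq> set L"
      using set_subseq_subset[OF u] set_subseq_subset[OF v] by auto
    have "u = [] \<and> v = [a, b, c] \<or> u = [a] \<and> v = [b, c] \<or> u = [a, b] \<and> v = [c] \<or> u = [a, b, c]"
      using uv by (auto simp: Cons_eq_append_conv)
    then consider "u = []" "v = [a, b, c]" | "u = [a]" "v = [b, c]" | "u = [a, b]" "v = [c]"
      | "u = [a, b, c]"
      by blast
    then show False
    proof cases
      case 1
      have "c \<le> M"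
        using 1 inR assms(2) less_imp_le by auto
      then have "a \<noteq> M"
        using \<open>a < c\<close> by simp
      then have "subseq [a, b, c] R"
        using 1 v by simp
      then show False
        using av \<open>a < c\<close> \<open>c < b\<close> unfolding avoids_132_iff by blast
    next
      case 2
      have "b \<le> M"
        using 2 inR assms(2) less_imp_le by auto
      then have "c \<noteq> M"
        using \<open>c < b\<close> by simp
      then have "a \<in> set L" "c \<in> set R"
        using 2 inL inR by auto
      then show False
        using av \<open>a < c\<close> less_asym by blast
    next
      case 3
      have "b < M"
        using 3 inL assms(2) by auto
      then have "c \<noteq> M"
        using \<open>c < b\<close> by simp
      then have "a \<in> set L" "c \<in> set R"
        using 3 inL inR by auto
      then show False
        using av \<open>a < c\<close> less_asym by blast
    next
      case 4
      then show False
        using u av \<open>a < c\<close> \<open>c < b\<close> unfolding avoids_132_iff by blast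
    qed
  qed
qed

text \<open>
  An occurrence of \<open>\<sigma> @ [m]\<close> that begins in \<open>L\<close> must end in \<open>L\<close> or at \<open>M\<close>, as
  everything after \<open>M\<close> is too small to be its largest entry; its part before the last entry
  is then an occurrence of \<open>\<sigma>\<close> in \<open>L\<close>. Conversely \<open>M\<close> extends every occurrence of \<open>\<sigma>\<close>
  in \<open>L\<close>. The hypothesis \<open>\<sigma> \<noteq> []\<close> matters: an occurrence of the pattern \<open>[m]\<close> is a single entry, which
  may be \<open>M\<close> itself.
\<close>

lemma avoids_snoc_split_at_max:
  assumes "distinct (L @ M # R)" and max: "\<forall>x \<in> set L \<union> set R. x < M"
    and below: "\<forall>l \<in> set L. \<forall>r \<in> set R. r < l"
    and m: "\<forall>b \<in> set \<sigma>. b < m" and "\<sigma> \<noteq> []"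
  shows "avoids (L @ M # R) (\<sigma> @ [m]) \<longleftrightarrow> avoids L \<sigma> \<and> avoids R (\<sigma> @ [m])"
proof
  assume av: "avoids (L @ M # R) (\<sigma> @ [m])"
  have "avoids L \<sigma>"
    unfolding avoids_def
  proof clarify
    fix s assume s: "subseq s L" "same_relative_order s \<sigma>"
    then have "\<forall>a \<in> set s. a < M"
      using max by (auto dest!: set_subseq_subset)
    then have "same_relative_order (s @ [M]) (\<sigma> @ [m])"
      using s by (simp add: same_relative_order_snoc[OF m])
    moreover have "subseq (s @ [M]) (L @ M # R)"
      using s by (intro list_emb_append_mono) auto
    ultimately show False
      using av unfolding avoids_def by blast
  qed
  moreover have "subseq R (L @ M # R)"
    by auto
  ultimately show "avoids L \<sigma> \<and> avoids R (\<sigma> @ [m])"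
    using av avoids_subseq by blast
next
  assume av: "avoids L \<sigma> \<and> avoids R (\<sigma> @ [m])"
  show "avoids (L @ M # R) (\<sigma> @ [m])"
    unfolding avoids_def
  proof clarify
    fix w assume sub: "subseq w (L @ M # R)" and ord: "same_relative_order w (\<sigma> @ [m])"
    then obtain s x where w: "w = s @ [x]"
      by (cases w rule: rev_cases) (auto simp: same_relative_order_def)
    then have s: "same_relative_order s \<sigma>" and less: "\<forall>a \<in> set s. a < x"
      using ord by (simp_all add: same_relative_order_snoc[OF m])
    have "s \<noteq> []"
      using s \<open>\<sigma> \<noteq> []\<close> by (auto simp: same_relative_order_def)
    obtain u v where uv: "s @ [x] = u @ v" and u: "subseq u L" and v: "subseq v (M # R)"
      using sub unfolding w subseq_append_iff by blast
    have inR: "set v \<subseteq> insert M (set R)" and inL: "set u \<subseteq> set L"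
      using set_subseq_subset[OF u] set_subseq_subset[OF v] by auto
    have "\<not> subseq s L"
      using av s unfolding avoids_def by blast
    have "subseq s (s @ [x])"
      by (simp add: list_emb_prefix)
    then have "v \<noteq> []"
      using uv u \<open>\<not> subseq s L\<close> subseq_order.order_trans[of s "s @ [x]" L] by auto
    then obtain v' where v': "v = v' @ [x]" "s = u @ v'"
      using uv by (cases v rule: rev_cases) auto
    show False
    proof (cases "x = M")
      case True
      \<comment> \<open>\<open>M\<close> is the head of \<open>M # R\<close>, so nothing of \<open>v\<close> precedes it.\<close>
      have "v' = []"
      proof (rule ccontr)
        assume "v' \<noteq> []"
        then obtain y v'' where "v' = y # v''"
          by (cases v') auto
        then have "y \<noteq> M"
          using less v' True by auto
        then have "subseq (y # v'' @ [M]) R"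
          using v v' True \<open>v' = y # v''\<close> by auto
        then have "M \<in> set R"
          by (auto dest!: set_subseq_subset)
        then show False
          using assms(1) by simp
      qed
      then show False
        using v' u \<open>\<not> subseq s L\<close> by simp
    next
      case False
      then have "x \<in> set R"
        using inR v' by auto
      then have "u = []"
        using inL v' less below by (cases u) (auto dest: less_asym)
      obtain y s' where "s = y # s'"
        using \<open>s \<noteq> []\<close> by (cases s) auto
      then have "y < x" "v = y # s' @ [x]"
        using less v' \<open>u = []\<close> by auto
      moreover have "x < M"
        using max \<open>x \<in> set R\<close> by blast
      ultimately have "subseq w R"
        using v w \<open>s = y # s'\<close> by auto
      then show False
        using av ord unfolding avoids_def by blast
    qed
  qed
qed

section \<open>Counting avoiders recursively\<close>

definition upper_lower_splits :: "nat set \<Rightarrow> (nat set \<times> nat set) set" where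
  "upper_lower_splits B = {(U, D). U \<union> D = B \<and> (\<forall>u \<in> U. \<forall>d \<in> D. d < u)}"

lemma finite_upper_lower_splits [simp]: "finite B \<Longrightarrow> finite (upper_lower_splits B)"
  by (rule finite_subset[of _ "Pow B \<times> Pow B"]) (auto simp: upper_lower_splits_def)

text \<open>
  Cutting at the maximum is a bijection, with the value sets \<open>U\<close> of \<open>L\<close> and \<open>D\<close> of \<open>R\<close>
  ranging over the ways to cut the remaining values into an upper and a lower part. For
  \<open>\<sigma> = 12\<cdots>(k-1)\<close> and \<open>A = {1..n}\<close> the formula is the coefficient form of
  \<open>F\<^sub>k = 1 + x F\<^sub>k\<^sub>-\<^sub>1 F\<^sub>k\<close>, where \<open>F\<^sub>k\<close> is the generating function of the
  permutations that avoid 132 and \<open>12\<cdots>k\<close>.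
\<close>

lemma card_avoiders_on_snoc:
  assumes "finite A" "A \<noteq> {}" and m: "\<forall>b \<in> set \<sigma>. b < m" and "\<sigma> \<noteq> []"
  shows "card (avoiders_on A (\<sigma> @ [m])) =
           (\<Sum>(U, D) \<in> upper_lower_splits (A - {Max A}).
              card (avoiders_on U \<sigma>) * card (avoiders_on D (\<sigma> @ [m])))"
proof -
  define M where "M = Max A"
  define S where "S = upper_lower_splits (A - {M})"
  \<comment> \<open>The value sets are carried along only so that the domain is a dependent sum over \<open>S\<close>.\<close>
  define glue where "glue = (\<lambda>(UD :: nat set \<times> nat set, L, R). L @ M # R)"
  define T where "T = Sigma S (\<lambda>(U, D). avoiders_on U \<sigma> \<times> avoiders_on D (\<sigma> @ [m]))"
  have M: "M \<in> A" "\<forall>x \<in> A - {M}. x < M"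
    using assms by (auto simp: M_def order.not_eq_order_implies_strict)
  have split: "(L @ M # R \<in> avoiders_on A (\<sigma> @ [m])) \<longleftrightarrow>
      ((set L, set R) \<in> S \<and> L \<in> avoiders_on (set L) \<sigma> \<and> R \<in> avoiders_on (set R) (\<sigma> @ [m]))"
    for L R
  proof (cases "distinct (L @ M # R) \<and> set L \<union> set R = A - {M}")
    case True
    then have d: "distinct (L @ M # R)" and A: "A = insert M (set L \<union> set R)"
      and lt: "\<forall>x \<in> set L \<union> set R. x < M"
      using M by auto
    show ?thesis
      using True d A avoids_132_split_at_max[OF d lt] avoids_snoc_split_at_max[OF d lt _ m \<open>\<sigma> \<noteq> []\<close>]
      by (auto simp: avoiders_on_def S_def upper_lower_splits_def permutations_of_set_def)
  next
    case False
    then have "L @ M # R \<notin> avoiders_on A (\<sigma> @ [m])"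
      using M by (auto simp: avoiders_on_def permutations_of_set_def)
    moreover have "distinct (L @ M # R) \<and> set L \<union> set R = A - {M}"
      if "(set L, set R) \<in> S" "L \<in> avoiders_on (set L) \<sigma>" "R \<in> avoiders_on (set R) (\<sigma> @ [m])"
      using that by (auto simp: avoiders_on_def S_def upper_lower_splits_def permutations_of_set_def)
    ultimately show ?thesis
      using False by blast
  qed
  have T: "((U, D), L, R) \<in> T \<longleftrightarrow> U = set L \<and> D = set R \<and> L @ M # R \<in> avoiders_on A (\<sigma> @ [m])"
    for U D L R
    unfolding T_def split by (auto simp: avoiders_on_def permutations_of_set_def)
  have "bij_betw glue T (avoiders_on A (\<sigma> @ [m]))"
  proof (rule bij_betw_imageI)
    have "U = U' \<and> D = D' \<and> L = L' \<and> R = R'"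
      if "((U, D), L, R) \<in> T" "((U', D'), L', R') \<in> T" "L @ M # R = L' @ M # R'"
      for U D L R U' D' L' R'
    proof -
      have "distinct (L @ M # R)"
        using that(1) by (simp add: T avoiders_on_def permutations_of_set_def)
      then have notin: "M \<notin> set L" "M \<notin> set R"
        by simp_all
      have "L = L' \<and> R = R'"
        using that(3) append_Cons_eq_iff[OF notin] by simp
      then show ?thesis
        using that(1,2) by (simp add: T)
    qed
    then show "inj_on glue T"
      by (fastforce simp: inj_on_def glue_def)
    show "glue ` T = avoiders_on A (\<sigma> @ [m])"
    proof (intro subset_antisym subsetI)
      fix \<pi> assume \<pi>: "\<pi> \<in> avoiders_on A (\<sigma> @ [m])"
      then have "M \<in> set \<pi>"
        using M by (simp add: avoiders_on_def permutations_of_set_def)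
      then obtain L R where "\<pi> = L @ M # R"
        by (meson split_list)
      then have "((set L, set R), L, R) \<in> T" "\<pi> = glue ((set L, set R), L, R)"
        using \<pi> T by (auto simp: glue_def)
      then show "\<pi> \<in> glue ` T"
        by blast
    qed (auto simp: glue_def T)
  qed
  then have "card (avoiders_on A (\<sigma> @ [m])) = card T"
    by (simp add: bij_betw_same_card)
  also have "\<dots> = (\<Sum>(U, D) \<in> S. card (avoiders_on U \<sigma>) * card (avoiders_on D (\<sigma> @ [m])))"
    using \<open>finite A\<close> by (simp add: T_def S_def card_SigmaI case_prod_unfold card_cartesian_product)
  finally show ?thesis
    by (simp add: S_def M_def)
qed

text \<open>
  In the recursion the lower part \<open>D\<close> is a proper subset of \<open>A\<close>, so strong induction on \<open>A\<close>
  applies to the second factor, and the hypothesis on \<open>\<sigma>\<close> and \<open>\<sigma>'\<close> to the first.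
\<close>

lemma card_avoiders_on_snoc_cong:
  assumes same: "\<And>B. finite B \<Longrightarrow> card (avoiders_on B \<sigma>) = card (avoiders_on B \<sigma>')"
    and "\<forall>b \<in> set \<sigma>. b < m" "\<sigma> \<noteq> []" and "\<forall>b \<in> set \<sigma>'. b < m'" "\<sigma>' \<noteq> []"
    and "finite A"
  shows "card (avoiders_on A (\<sigma> @ [m])) = card (avoiders_on A (\<sigma>' @ [m']))"
  using \<open>finite A\<close>
proof (induction A rule: finite_psubset_induct)
  case (psubset A)
  show ?case
  proof (cases "A = {}")
    case True
    have "avoiders_on {} (\<rho> @ [r]) = {[]}" for \<rho> r
      by (auto simp: avoiders_on_def avoids_def same_relative_order_def)
    then show ?thesis
      using True by simp
  next
    case False
    have "card (avoiders_on U \<sigma>) = card (avoiders_on U \<sigma>') \<and>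
          card (avoiders_on D (\<sigma> @ [m])) = card (avoiders_on D (\<sigma>' @ [m']))"
      if "(U, D) \<in> upper_lower_splits (A - {Max A})" for U D
    proof -
      have "U \<subseteq> A" "D \<subset> A"
        using that Max_in[OF psubset.hyps False] by (auto simp: upper_lower_splits_def)
      then show ?thesis
        using same[of U] psubset.IH[of D] finite_subset[OF _ psubset.hyps] by blast
    qed
    then show ?thesis
      unfolding card_avoiders_on_snoc[OF psubset.hyps False assms(2,3)]
        card_avoiders_on_snoc[OF psubset.hyps False assms(4,5)]
      by (intro sum.cong refl) auto
  qed
qed

section \<open>Patterns of length two\<close>

lemma sorted_wrt_iff_subseq:
  "sorted_wrt P xs \<longleftrightarrow> (\<forall>x y. subseq [x, y] xs \<longrightarrow> P x y)"
proof (induction xs)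
  case (Cons a xs)
  have "subseq [x, y] (a # xs) \<longleftrightarrow> subseq [x, y] xs \<or> x = a \<and> y \<in> set xs" for x y
    using subseq_Cons'[of x "[y]" xs] by (auto simp: subseq_singleton_left)
  then show ?case
    using Cons.IH by auto
qed simp

lemma avoids_length_2_iff:
  "avoids \<pi> [p, q] \<longleftrightarrow> sorted_wrt (\<lambda>x y. \<not> same_relative_order [x, y] [p, q]) \<pi>"
proof -
  have "\<exists>x y. \<sigma> = [x, y]" if "same_relative_order \<sigma> [p, q]" for \<sigma>
    using that by (auto simp: same_relative_order_def length_Suc_conv)
  then show ?thesis
    unfolding avoids_def sorted_wrt_iff_subseq by blast
qed

lemma avoids_12_iff: "avoids \<pi> [1, 2] \<longleftrightarrow> sorted (rev \<pi>)"
proof -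
  have "same_relative_order [x, y] [1, 2] \<longleftrightarrow> x < y" for x y
    by (auto simp: same_relative_order_def less_Suc_eq all_conj_distrib)
  then show ?thesis
    by (simp add: avoids_length_2_iff sorted_wrt_rev not_less)
qed

lemma avoids_21_iff: "avoids \<pi> [2, 1] \<longleftrightarrow> sorted \<pi>"
proof -
  have "same_relative_order [x, y] [2, 1] \<longleftrightarrow> y < x" for x y
    by (auto simp: same_relative_order_def less_Suc_eq all_conj_distrib)
  then show ?thesis
    by (simp add: avoids_length_2_iff not_less)
qed

lemma avoids_132_if_avoids_length_2:
  assumes "avoids \<pi> [1, 2] \<or> avoids \<pi> [2, 1]"
  shows "avoids \<pi> [1, 3, 2]"
  unfolding avoids_132_iff
proof clarify
  fix a b c assume abc: "subseq [a, b, c] \<pi>" "a < c" "c < b"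
  have "avoids [a, b, c] [1, 2] \<or> avoids [a, b, c] [2, 1]"
    using assms abc(1) avoids_subseq by blast
  then show False
    unfolding avoids_12_iff avoids_21_iff using abc by auto
qed

lemma card_avoiders_on_length_2:
  assumes "finite A"
  shows "card (avoiders_on A [1, 2]) = 1" "card (avoiders_on A [2, 1]) = 1"
proof -
  have sorted: "\<pi> = sorted_list_of_set (set \<pi>)" if "distinct \<pi>" "sorted \<pi>" for \<pi>
    using that by (simp add: sorted_list_of_set.idem_if_sorted_distinct)
  have "avoiders_on A [2, 1] = {sorted_list_of_set A}"
    using assms avoids_132_if_avoids_length_2
    by (auto simp: avoiders_on_def avoids_21_iff permutations_of_set_def simp del: One_nat_def intro: sorted)
  then show "card (avoiders_on A [2, 1]) = 1"
    by simp
  have "\<pi> = rev (sorted_list_of_set A)" if "set \<pi> = A" "distinct \<pi>" "sorted (rev \<pi>)" for \<pi>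
    using sorted[of "rev \<pi>"] that by (simp add: rev_swap)
  then have "avoiders_on A [1, 2] = {rev (sorted_list_of_set A)}"
    using assms avoids_132_if_avoids_length_2
    by (auto simp: avoiders_on_def avoids_12_iff permutations_of_set_def simp del: One_nat_def)
  then show "card (avoiders_on A [1, 2]) = 1"
    by simp
qed

section \<open>The patterns \<open>12\<cdots>k\<close> and \<open>213\<cdots>k\<close>\<close>

lemma card_avoiders_on_12_upt_eq_21_upt:
  assumes "k \<ge> 2" "finite A"
  shows "card (avoiders_on A [1..<Suc k]) = card (avoiders_on A (2 # 1 # [3..<Suc k]))"
  using assms
proof (induction k arbitrary: A rule: dec_induct)
  case base
  have "[1..<Suc 2] = [1, 2]" "2 # 1 # [3..<Suc 2] = [2, 1]"
    by (simp_all add: upt_rec)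
  then show ?case
    using base by (simp only: card_avoiders_on_length_2)
next
  case (step k)
  have "[1..<Suc (Suc k)] = [1..<Suc k] @ [Suc k]"
    "2 # 1 # [3..<Suc (Suc k)] = (2 # 1 # [3..<Suc k]) @ [Suc k]"
    using step.hyps by simp_all
  then show ?case
    using step card_avoiders_on_snoc_cong[of "[1..<Suc k]" "2 # 1 # [3..<Suc k]" "Suc k" "Suc k" A]
    by (simp del: upt_Suc)
qed

theorem corollary4p4:
  fixes n k :: nat
  assumes "k \<ge> 3"
  shows "card (avoiders n [1, 3, 2] [1..<Suc k]) = card (avoiders n [1, 3, 2] (2 # 1 # [3..<Suc k]))"
proof -
  have "avoiders n [1, 3, 2] \<tau> = avoiders_on {1..n} \<tau>" for \<tau>
    by (simp add: avoiders_def avoiders_on_def)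
  then show ?thesis
    using card_avoiders_on_12_upt_eq_21_upt[of k "{1..n}"] assms by simp
qed

end
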